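(* Let $q$ be a prime power and let $m,u$ be integers with $m>1$ and $1\le u\le m-1$. Then the code $B_{u,m}$ is quasi-perfect uniformly packed (hence completely regular), with intersection array $$\{b_0,b_1;c_1,c_2\}=\{q^m-q^u,\; q^u-1;\; 1,\; q^m-q^u\}.$$
   Context: $\mathbb{F}_q$ is the finite field of order $q$; $d(\cdot,\cdot)$ is the Hamming distance on $\mathbb{F}_q^n$. For a code $C\subset\mathbb{F}_q^n$, $d$ is its minimum distance, $e=\lfloor (d-1)/2\rfloor$ its packing radius, $d(\mathbf v,C)=\min_{\mathbf x\in C}d(\mathbf v,\mathbf x)$, and $\rho=\max_{\mathbf v\in\mathbb{F}_q^n}d(\mathbf v,C)$ its covering radius. $C$ is quasi-perfect if $e=\rho-1$. Put $C(i)=\{\mathbf x\in\mathbb{F}_q^n: d(\mathbf x,C)=i\}$, $0\le i\le\rho$. Two vectors are neighbors if they are at distance $1$. $C$ is completely regular if for all $0\le l\le\rho$ every vector $\mathbf x\in C(l)$ has the same number $c_l$ of neighbors in $C(l-1)$ and the same number $b_l$ of neighbors in $C(l+1)$ (with $c_0=b_\rho=0$). Its intersection array is $\{b_0,\dots,b_{\rho-1};c_1,\dots,c_\rho\}$. A quasi-perfect code $C$ with packing radius $e$ is uniformly packed if there exist natural numbers $\lambda,\mu$ (zero allowed) such that, for every vector $\mathbf x$, the number of codewords at distance exactly $e+1$ from $\mathbf x$ equals $\lambda$ if $d(\mathbf x,C)=e$, and equals $\mu$ if $d(\mathbf x,C)=e+1$. Let $H_m$ be an $m\times (q^m-1)/(q-1)$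 matrix over $\mathbb{F}_q$ whose columns form a maximal set of pairwise linearly independent vectors of $\mathbb{F}_q^m$ (a parity-check matrix of the $q$-ary Hamming code). For $1\le u\le m-1$ order the columns so that $H_m=[\,H_u^*\mid H_{u,m}\,]$, where $H_u^*$ consists of the $(q^u-1)/(q-1)$ columns whose last $m-u$ entries are all zero, and $H_{u,m}$ consists of the remaining $n_B=(q^m-q^u)/(q-1)$ columns. Then $B_{u,m}=\{\mathbf x\in\mathbb{F}_q^{n_B}: H_{u,m}\mathbf x^T=\mathbf 0^T\}$. Convention for the degenerate case $(q,m,u)=(2,2,1)$: there $B_{u,m}=\{(0,0)\}$ has a single codeword, and its minimum distance is taken by convention to be $4$ (so $e=1$). *)

theory Defs
  imports "Jordan_Normal_Form.Matrix_Kernel" "HOL-Library.Cardinality"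
begin

text \<open>
  The field \<open>\<F>\<^sub>q\<close> is a type \<open>'a\<close> of sort \<open>{field, finite}\<close> with \<open>q = CARD('a)\<close>, the space
  \<open>\<F>\<^sub>q\<^sup>n\<close> is \<^const>\<open>carrier_vec\<close> \<open>n\<close>, and codes are subsets of it.
\<close>

definition hamming_dist :: "'a vec \<Rightarrow> 'a vec \<Rightarrow> nat" where
  "hamming_dist x y = card {i. i < dim_vec x \<and> x $ i \<noteq> y $ i}"

text \<open>
  The code consisting of the zero word of length 2 over the field with two elements
  has no pair of distinct codewords; its minimum distance is 4 by convention.
\<close>

definition min_distance :: "'a::{field,finite} vec set \<Rightarrow> nat" where
  "min_distance C =
     (if CARD('a) = 2 \<and> C = {0\<^sub>v 2} then 4
      else Min {hamming_dist x y | x y. x \<in> C \<and> y \<in> C \<and> x \<noteq> y})"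

definition packing_radius :: "'a::{field,finite} vec set \<Rightarrow> nat" where
  "packing_radius C = (min_distance C - 1) div 2"

definition dist_to_code :: "'a vec \<Rightarrow> 'a vec set \<Rightarrow> nat" where
  "dist_to_code v C = Min {hamming_dist v x | x. x \<in> C}"

definition covering_radius :: "nat \<Rightarrow> 'a vec set \<Rightarrow> nat" where
  "covering_radius n C = Max {dist_to_code v C | v. v \<in> carrier_vec n}"

text \<open>Written without subtraction, which truncates on \<^typ>\<open>nat\<close>.\<close>

definition quasi_perfect :: "nat \<Rightarrow> 'a::{field,finite} vec set \<Rightarrow> bool" where
  "quasi_perfect n C \<longleftrightarrow> packing_radius C + 1 = covering_radius n C"

definition layer :: "nat \<Rightarrow> 'a vec set \<Rightarrow> nat \<Rightarrow> 'a vec set" where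
  "layer n C i = {x \<in> carrier_vec n. dist_to_code x C = i}"

definition neighbors :: "nat \<Rightarrow> 'a vec \<Rightarrow> 'a vec set" where
  "neighbors n x = {y \<in> carrier_vec n. hamming_dist x y = 1}"

definition intersection_numbers ::
    "nat \<Rightarrow> 'a vec set \<Rightarrow> (nat \<Rightarrow> nat) \<Rightarrow> (nat \<Rightarrow> nat) \<Rightarrow> bool" where
  "intersection_numbers n C b c \<longleftrightarrow>
     c 0 = 0 \<and> b (covering_radius n C) = 0 \<and>
     (\<forall>l \<le> covering_radius n C. \<forall>x \<in> layer n C l.
        (l > 0 \<longrightarrow> card (neighbors n x \<inter> layer n C (l - 1)) = c l) \<and>
        card (neighbors n x \<inter> layer n C (l + 1)) = b l)"

definition completely_regular :: "nat \<Rightarrow> 'a vec set \<Rightarrow> bool" where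
  "completely_regular n C \<longleftrightarrow> (\<exists>b c. intersection_numbers n C b c)"

text \<open>
  The lists are \<open>[b\<^sub>0, \<dots>, b\<^bsub>\<rho>-1\<^esub>]\<close> and \<open>[c\<^sub>1, \<dots>, c\<^sub>\<rho>]\<close>; in particular
  their common length is the covering radius \<open>\<rho>\<close>.
\<close>

definition has_intersection_array :: "nat \<Rightarrow> 'a vec set \<Rightarrow> nat list \<Rightarrow> nat list \<Rightarrow> bool" where
  "has_intersection_array n C bs cs \<longleftrightarrow>
     (\<exists>b c. intersection_numbers n C b c \<and>
        bs = map b [0..<covering_radius n C] \<and>
        cs = map c [1..<covering_radius n C + 1])"

definition uniformly_packed :: "nat \<Rightarrow> 'a::{field,finite} vec set \<Rightarrow> bool" where
  "uniformly_packed n C \<longleftrightarrow>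
     quasi_perfect n C \<and>
     (\<exists>k \<mu> :: nat. \<forall>x \<in> carrier_vec n.
        (dist_to_code x C = packing_radius C \<longrightarrow>
           card {y \<in> C. hamming_dist x y = packing_radius C + 1} = k) \<and>
        (dist_to_code x C = packing_radius C + 1 \<longrightarrow>
           card {y \<in> C. hamming_dist x y = packing_radius C + 1} = \<mu>))"

text \<open>The case \<open>x = y\<close> says that the vectors are nonzero.\<close>

definition pairwise_lin_indpt :: "nat \<Rightarrow> 'a::field vec set \<Rightarrow> bool" where
  "pairwise_lin_indpt m S \<longleftrightarrow>
     S \<subseteq> carrier_vec m \<and>
     (\<forall>x \<in> S. \<forall>y \<in> S. LinearCombinations.module.lin_indpt class_ring (module_vec TYPE('a) m) {x, y})"

definition hamming_parity_check :: "nat \<Rightarrow> 'a::{field,finite} mat \<Rightarrow> bool" where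
  "hamming_parity_check m H \<longleftrightarrow>
     H \<in> carrier_mat m ((CARD('a) ^ m - 1) div (CARD('a) - 1)) \<and>
     distinct (cols H) \<and>
     pairwise_lin_indpt m (set (cols H)) \<and>
     (\<forall>T. set (cols H) \<subseteq> T \<and> pairwise_lin_indpt m T \<longrightarrow> T = set (cols H))"

text \<open>\<open>H = [Hs | Hr]\<close>, where \<open>Hs\<close> collects the columns whose last \<open>m - u\<close> entries vanish.\<close>

definition hamming_split ::
    "nat \<Rightarrow> nat \<Rightarrow> 'a::{field,finite} mat \<Rightarrow> 'a mat \<Rightarrow> 'a mat \<Rightarrow> bool" where
  "hamming_split m u H Hs Hr \<longleftrightarrow>
     hamming_parity_check m H \<and>
     Hs \<in> carrier_mat m ((CARD('a) ^ u - 1) div (CARD('a) - 1)) \<and>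
     Hr \<in> carrier_mat m ((CARD('a) ^ m - CARD('a) ^ u) div (CARD('a) - 1)) \<and>
     cols H = cols Hs @ cols Hr \<and>
     (\<forall>v \<in> set (cols Hs). \<forall>i. u \<le> i \<and> i < m \<longrightarrow> v $ i = 0) \<and>
     (\<forall>v \<in> set (cols Hr). \<exists>i. u \<le> i \<and> i < m \<and> v $ i \<noteq> 0)"

end

theory Submission
  imports Defs "Berlekamp_Zassenhaus.Berlekamp_Type_Based"
begin

text \<open>
  Let \<open>U\<close> be the subspace of \<open>V = \<F>\<^sub>q\<^sup>m\<close> on which the last \<open>m - u\<close> coordinates vanish. The columns of
  a Hamming parity-check matrix represent each line of \<open>V\<close> once, so the columns of \<open>Hr\<close> represent
  each line not contained in \<open>U\<close> once (\<open>bij_betw_multiples_of_columns\<close>). Changing one entry of a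
  word adds a nonzero multiple of one column to its syndrome. Hence the syndrome maps the
  neighbors of \<open>x\<close> bijectively onto the vectors \<open>t \<in> V\<close> with \<open>t - syn x \<notin> U\<close>
  (\<open>bij_betw_syn_neighbors\<close>), and counting neighbors becomes counting vectors in \<open>V\<close>.

  The code \<open>B\<close> is the set of words with syndrome \<open>0\<close>. So the words with syndrome outside \<open>U\<close> are at
  distance 1 from \<open>B\<close>, and those with nonzero syndrome in \<open>U\<close> are at distance 2 (\<open>dist_to_B\<close>).
  Therefore \<open>\<rho> = 2\<close>, and the intersection numbers are the numbers of vectors \<open>t\<close> in \<open>{0}\<close>, in
  \<open>V - U\<close> and in \<open>U - {0}\<close> with \<open>t - syn x \<notin> U\<close> (\<open>card_neighbors_layers\<close>).

  The remaining properties follow from this local structure. A word with syndrome outside \<open>U\<close>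
  has exactly one codeword neighbor, and a word with syndrome in \<open>U\<close> has none. Since two words at
  distance 2 have exactly two common neighbors, the number of paths \<open>x - y - c\<close> that end in a
  codeword \<open>c\<close> at distance 2 from \<open>x\<close> is twice the number of codewords at distance 2 from \<open>x\<close> (\<open>two_card_codewords_at_dist_2\<close>); the
  result depends only on the distance of \<open>x\<close> from \<open>B\<close>, so \<open>B\<close> is uniformly packed. The same facts
  show that no two codewords are at distance 1 or 2 from each other. Conversely, a word in the outermost layer has
  \<open>(q\<^sup>m - q\<^sup>u) / 2\<close> codewords at distance 2. If there are at least two of them, they are at distance
  at most 4 from each other and the minimum distance is 3 or 4. Otherwise \<open>q\<^sup>m - q\<^sup>u \<le> 2\<close>, which
  forces \<open>q = 2\<close> and length 2: the degenerate code \<open>{0}\<close>. In each case the packing radius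
  is 1 (\<open>packing_radius_B\<close>).
\<close>

section \<open>The Hamming graph\<close>

lemma hamming_dist_eq_0_iff:
  assumes "x \<in> carrier_vec n" "y \<in> carrier_vec n"
  shows "hamming_dist x y = 0 \<longleftrightarrow> x = y"
  using assms by (auto simp: hamming_dist_def)

lemma hamming_dist_commute:
  assumes "dim_vec x = dim_vec y"
  shows "hamming_dist x y = hamming_dist y x"
  using assms unfolding hamming_dist_def by metis

lemma hamming_dist_le_dim: "hamming_dist x y \<le> dim_vec x"
proof -
  have "card {i. i < dim_vec x \<and> x $ i \<noteq> y $ i} \<le> card {..<dim_vec x}"
    by (rule card_mono) auto
  then show ?thesis by (simp add: hamming_dist_def)
qed

lemma hamming_dist_triangle:
  assumes "dim_vec x = dim_vec y"
  shows "hamming_dist x z \<le> hamming_dist x y + hamming_dist y z"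
proof -
  have "hamming_dist x z
      \<le> card ({i. i < dim_vec x \<and> x $ i \<noteq> y $ i} \<union> {i. i < dim_vec y \<and> y $ i \<noteq> z $ i})"
    unfolding hamming_dist_def by (rule card_mono) (use assms in auto)
  also have "\<dots> \<le> hamming_dist x y + hamming_dist y z"
    unfolding hamming_dist_def by (rule card_Un_le)
  finally show ?thesis .
qed

lemma neighbors_subset_carrier: "neighbors n x \<subseteq> carrier_vec n"
  by (auto simp: neighbors_def)

lemma finite_neighbors [simp]: "finite (neighbors n (x :: 'a::finite vec))"
  by (rule finite_subset[OF neighbors_subset_carrier]) simp

lemma mem_neighbors_commute:
  assumes "x \<in> carrier_vec n" "y \<in> carrier_vec n"
  shows "y \<in> neighbors n x \<longleftrightarrow> x \<in> neighbors n y"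
  using assms hamming_dist_commute[of x y] by (auto simp: neighbors_def)

lemma neighbors_eq_image:
  fixes x :: "'a::field vec"
  assumes x: "x \<in> carrier_vec n"
  shows "neighbors n x = (\<lambda>(i, a). x + a \<cdot>\<^sub>v unit_vec n i) ` ({..<n} \<times> (UNIV - {0}))"
proof (intro equalityI subsetI)
  fix y assume "y \<in> neighbors n x"
  then have y: "y \<in> carrier_vec n" and "card {i. i < n \<and> x $ i \<noteq> y $ i} = 1"
    using x by (auto simp: neighbors_def hamming_dist_def)
  then obtain i where i: "{i. i < n \<and> x $ i \<noteq> y $ i} = {i}"
    by (auto simp: card_1_singleton_iff)
  have "y = x + (y $ i - x $ i) \<cdot>\<^sub>v unit_vec n i"
  proof (rule eq_vecI)
    fix j assume "j < dim_vec (x + (y $ i - x $ i) \<cdot>\<^sub>v unit_vec n i)"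
    then have j: "j < n" using x by simp
    moreover have "i < n" using i by blast
    moreover have "x $ j = y $ j" if "j \<noteq> i" using i j that by blast
    ultimately show "y $ j = (x + (y $ i - x $ i) \<cdot>\<^sub>v unit_vec n i) $ j"
      using x y by (cases "j = i") simp_all
  qed (use x y in auto)
  moreover have "i < n" "x $ i \<noteq> y $ i" using i by blast+
  then have "i < n" "y $ i - x $ i \<noteq> 0" by auto
  ultimately show "y \<in> (\<lambda>(i, a). x + a \<cdot>\<^sub>v unit_vec n i) ` ({..<n} \<times> (UNIV - {0}))"
    by (intro image_eqI[of _ _ "(i, y $ i - x $ i)"]) auto
next
  fix y assume "y \<in> (\<lambda>(i, a). x + a \<cdot>\<^sub>v unit_vec n i) ` ({..<n} \<times> (UNIV - {0}))"
  then obtain i a where i: "i < n" "a \<noteq> 0" and y: "y = x + a \<cdot>\<^sub>v unit_vec n i" by auto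
  have "{j. j < n \<and> x $ j \<noteq> y $ j} = {i}"
    using i x by (auto simp: y unit_vec_def split: if_splits)
  then show "y \<in> neighbors n x" using x by (simp add: neighbors_def hamming_dist_def y)
qed

lemma bij_betw_neighbors:
  fixes x :: "'a::field vec"
  assumes x: "x \<in> carrier_vec n"
  shows "bij_betw (\<lambda>(i, a). x + a \<cdot>\<^sub>v unit_vec n i) ({..<n} \<times> (UNIV - {0})) (neighbors n x)"
proof -
  have "inj_on (\<lambda>(i, a). x + a \<cdot>\<^sub>v unit_vec n i) ({..<n} \<times> (UNIV - {0}))"
  proof (rule inj_onI)
    fix p q
    assume pq: "p \<in> {..<n} \<times> (UNIV - {0 :: 'a})" "q \<in> {..<n} \<times> (UNIV - {0 :: 'a})"
      and eq: "(case p of (i, a) \<Rightarrow> x + a \<cdot>\<^sub>v unit_vec n i) = (case q of (i, a) \<Rightarrow> x + a \<cdot>\<^sub>v unit_vec n i)"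
    obtain i a j b where [simp]: "p = (i, a)" "q = (j, b)" by (cases p, cases q)
    have "(x + a \<cdot>\<^sub>v unit_vec n i) $ i = (x + b \<cdot>\<^sub>v unit_vec n j) $ i"
      using eq by simp
    then show "p = q"
      using pq x by (cases "i = j") auto
  qed
  then show ?thesis by (simp add: bij_betw_def neighbors_eq_image[OF x])
qed

text \<open>
  Adjacent words differ in a single position, and a common neighbor can differ from them only in
  that position, where it takes one of the remaining values.
\<close>

lemma card_common_neighbors_of_adjacent:
  fixes x y :: "'a::finite vec"
  assumes x: "x \<in> carrier_vec n" and y: "y \<in> neighbors n x"
  shows "card (neighbors n x \<inter> neighbors n y) = CARD('a) - 2"
proof -
  have y': "y \<in> carrier_vec n" and "card {i. i < n \<and> x $ i \<noteq> y $ i} = 1"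
    using y x by (auto simp: neighbors_def hamming_dist_def)
  then obtain i where D: "{i. i < n \<and> x $ i \<noteq> y $ i} = {i}"
    by (auto simp: card_1_singleton_iff)
  then have i: "i < n" "x $ i \<noteq> y $ i" and off: "\<And>j. j < n \<Longrightarrow> j \<noteq> i \<Longrightarrow> x $ j = y $ j"
    by blast+
  let ?z = "\<lambda>b. vec n (\<lambda>j. if j = i then b else x $ j)"
  have "neighbors n x \<inter> neighbors n y = ?z ` (UNIV - {x $ i, y $ i})"
  proof (intro equalityI subsetI)
    fix z assume "z \<in> neighbors n x \<inter> neighbors n y"
    then have z: "z \<in> carrier_vec n" and "card {j. j < n \<and> x $ j \<noteq> z $ j} = 1"
      "card {j. j < n \<and> y $ j \<noteq> z $ j} = 1"
      using x y' by (auto simp: neighbors_def hamming_dist_def)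
    then obtain k l where kl: "{j. j < n \<and> x $ j \<noteq> z $ j} = {k}"
      "{j. j < n \<and> y $ j \<noteq> z $ j} = {l}"
      by (auto simp: card_1_singleton_iff)
    have kx: "x $ t = z $ t" if "t < n" "t \<noteq> k" for t using kl(1) that by blast
    have ly: "y $ t = z $ t" if "t < n" "t \<noteq> l" for t using kl(2) that by blast
    have k: "k < n" "x $ k \<noteq> z $ k" and l: "l < n" "y $ l \<noteq> z $ l" using kl by blast+
    have "k = i"
    proof (rule ccontr)
      assume "k \<noteq> i"
      then have "x $ i = z $ i" using kx[of i] i by metis
      then have "i = l" using ly[of i] i by metis
      moreover have "k = l" using ly[of k] off[of k] k \<open>k \<noteq> i\<close> by metis
      ultimately show False using \<open>k \<noteq> i\<close> by simp
    qed
    moreover have "l = i"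
    proof (rule ccontr)
      assume "l \<noteq> i"
      then show False using off[of l] kx[of l] l \<open>k = i\<close> by metis
    qed
    ultimately have "x $ i \<noteq> z $ i" "y $ i \<noteq> z $ i"
      and zoff: "\<And>t. t < n \<Longrightarrow> t \<noteq> i \<Longrightarrow> x $ t = z $ t"
      using k l kx by simp_all
    then have "z $ i \<in> UNIV - {x $ i, y $ i}" by simp
    moreover have "z = ?z (z $ i)"
    proof (rule eq_vecI)
      fix t assume "t < dim_vec (?z (z $ i))"
      then have "t < n" by simp
      then show "z $ t = ?z (z $ i) $ t" using zoff[of t] by (cases "t = i") simp_all
    qed (use z in simp)
    ultimately show "z \<in> ?z ` (UNIV - {x $ i, y $ i})" by (rule rev_image_eqI)
  next
    fix z assume "z \<in> ?z ` (UNIV - {x $ i, y $ i})"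
    then obtain b where b: "b \<noteq> x $ i" "b \<noteq> y $ i" and z: "z = ?z b" by auto
    have "{j. j < n \<and> x $ j \<noteq> z $ j} = {i}" "{j. j < n \<and> y $ j \<noteq> z $ j} = {i}"
      using b i off by (auto simp: z split: if_splits)
    then show "z \<in> neighbors n x \<inter> neighbors n y"
      using x y' by (simp add: neighbors_def hamming_dist_def z)
  qed
  moreover have "inj_on ?z (UNIV - {x $ i, y $ i})"
  proof (rule inj_onI)
    fix b c assume "?z b = ?z c"
    then have "?z b $ i = ?z c $ i" by (rule arg_cong)
    then show "b = c" using i by simp
  qed
  ultimately have "card (neighbors n x \<inter> neighbors n y) = card (UNIV - {x $ i, y $ i})"
    by (simp add: card_image)
  also have "\<dots> = CARD('a) - 2"
    using i by (simp add: card_Diff_subset)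
  finally show ?thesis .
qed

text \<open>
  The common neighbors arise from one word by copying the entry of the other word at one of the
  two positions where they differ.
\<close>

lemma card_common_neighbors_of_dist_2:
  assumes x: "x \<in> carrier_vec n" and y: "y \<in> carrier_vec n" and d: "hamming_dist x y = 2"
  shows "card (neighbors n x \<inter> neighbors n y) = 2"
proof -
  have "card {i. i < n \<and> x $ i \<noteq> y $ i} = 2"
    using d x by (simp add: hamming_dist_def)
  then obtain i j where D: "{i. i < n \<and> x $ i \<noteq> y $ i} = {i, j}" and ij: "i \<noteq> j"
    by (auto simp: card_2_iff)
  have D': "t = i \<or> t = j" if "t < n" "x $ t \<noteq> y $ t" for t using D that by blast
  have i: "i < n" "x $ i \<noteq> y $ i" and j: "j < n" "x $ j \<noteq> y $ j" using D by blast+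
  define z where "z k = vec n (\<lambda>t. if t = k then y $ t else x $ t)" for k
  have z_carrier: "z k \<in> carrier_vec n" for k by (simp add: z_def)
  have z_at: "z k $ k = y $ k" if "k < n" for k using that by (simp add: z_def)
  have z_off: "z k $ t = x $ t" if "t < n" "t \<noteq> k" for k t using that by (simp add: z_def)
  have "neighbors n x \<inter> neighbors n y = {z i, z j}"
  proof
    show "neighbors n x \<inter> neighbors n y \<subseteq> {z i, z j}"
    proof
      fix w assume "w \<in> neighbors n x \<inter> neighbors n y"
      then have w: "w \<in> carrier_vec n" and "card {j. j < n \<and> x $ j \<noteq> w $ j} = 1"
        "card {j. j < n \<and> y $ j \<noteq> w $ j} = 1"
        using x y by (auto simp: neighbors_def hamming_dist_def)
      then obtain k l where kl: "{j. j < n \<and> x $ j \<noteq> w $ j} = {k}"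
        "{j. j < n \<and> y $ j \<noteq> w $ j} = {l}"
        by (auto simp: card_1_singleton_iff)
      have kx: "x $ t = w $ t" if "t < n" "t \<noteq> k" for t using kl(1) that by blast
      have ly: "y $ t = w $ t" if "t < n" "t \<noteq> l" for t using kl(2) that by blast
      have "i = k \<or> i = l" using kx[of i] ly[of i] i by metis
      moreover have "j = k \<or> j = l" using kx[of j] ly[of j] j by metis
      ultimately have k: "k = i \<or> k = j" "k \<noteq> l" using ij by auto
      have "w = z k"
      proof (rule eq_vecI)
        fix t assume "t < dim_vec (z k)"
        then have t: "t < n" using z_carrier[of k] by simp
        show "w $ t = z k $ t"
        proof (cases "t = k")
          case True
          then show ?thesis using ly[of t] z_at[of k] t k(2) by simp
        next
          case False
          then show ?thesis using kx[of t] z_off[of t k] t by simp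
        qed
      qed (use w z_carrier[of k] in simp)
      then show "w \<in> {z i, z j}" using k(1) by blast
    qed
  next
    have *: "z k \<in> neighbors n x \<inter> neighbors n y"
      if k: "k < n" "x $ k \<noteq> y $ k" and l: "l < n" "x $ l \<noteq> y $ l" and kl: "k \<noteq> l"
        and only: "\<And>t. t < n \<Longrightarrow> x $ t \<noteq> y $ t \<Longrightarrow> t = k \<or> t = l" for k l
    proof -
      have "x $ t \<noteq> z k $ t \<longleftrightarrow> t = k" "y $ t \<noteq> z k $ t \<longleftrightarrow> t = l" if t: "t < n" for t
      proof -
        consider "t = k" | "t = l" "t \<noteq> k" | "t \<noteq> k" "t \<noteq> l" by blast
        note cs = this
        show "x $ t \<noteq> z k $ t \<longleftrightarrow> t = k"
          using cs by cases (use z_at[of k] z_off[of t k] k t in simp_all)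
        show "y $ t \<noteq> z k $ t \<longleftrightarrow> t = l"
          using cs
        proof cases
          case 1
          then show ?thesis using z_at[OF k(1)] kl by simp
        next
          case 2
          then show ?thesis using z_off[OF t, of k] l(2) by simp
        next
          case 3
          then show ?thesis using z_off[OF t, of k] only[OF t] by fastforce
        qed
      qed
      then have "{t. t < n \<and> x $ t \<noteq> z k $ t} = {k}" "{t. t < n \<and> y $ t \<noteq> z k $ t} = {l}"
        using k(1) l(1) by blast+
      then show ?thesis using x y z_carrier[of k] by (simp add: neighbors_def hamming_dist_def)
    qed
    have "z i \<in> neighbors n x \<inter> neighbors n y"
      by (rule *[of i j]) (use i j ij D' in blast)+
    moreover have "z j \<in> neighbors n x \<inter> neighbors n y"
      by (rule *[of j i]) (use i j ij D' in blast)+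
    ultimately show "{z i, z j} \<subseteq> neighbors n x \<inter> neighbors n y" by blast
  qed
  moreover have "z i \<noteq> z j"
  proof
    assume "z i = z j"
    then have "z i $ i = z j $ i" by simp
    then show False using z_at[of i] z_off[of i j] i ij by simp
  qed
  ultimately show ?thesis by simp
qed

lemma dist_to_code_le_iff:
  assumes "C \<noteq> {}"
  shows "dist_to_code x C \<le> k \<longleftrightarrow> (\<exists>c \<in> C. hamming_dist x c \<le> k)"
proof -
  have "{hamming_dist x c | c. c \<in> C} \<subseteq> {..dim_vec x}"
    using hamming_dist_le_dim by auto
  then have "finite {hamming_dist x c | c. c \<in> C}"
    by (rule finite_subset) simp
  moreover have "{hamming_dist x c | c. c \<in> C} \<noteq> {}" using assms by auto
  ultimately show ?thesis unfolding dist_to_code_def by (subst Min_le_iff) auto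
qed

section \<open>Parity-check matrices of the Hamming code\<close>

definition coordinate_subspace :: "nat \<Rightarrow> nat \<Rightarrow> 'a::zero vec set" where
  "coordinate_subspace m u = {v \<in> carrier_vec m. \<forall>i. u \<le> i \<and> i < m \<longrightarrow> v $ i = 0}"

text \<open>Padding with zeros identifies it with the space of vectors of length \<open>u\<close>.\<close>

lemma card_coordinate_subspace:
  assumes "u \<le> m"
  shows "card (coordinate_subspace m u :: 'a::{field,finite} vec set) = CARD('a) ^ u"
proof -
  have "bij_betw (\<lambda>v. v @\<^sub>v 0\<^sub>v (m - u)) (carrier_vec u) (coordinate_subspace m u :: 'a vec set)"
  proof (rule bij_betwI[where g = "\<lambda>w. vec_first w u"])
    show "(\<lambda>v :: 'a vec. v @\<^sub>v 0\<^sub>v (m - u)) \<in> carrier_vec u \<rightarrow> coordinate_subspace m u"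
    proof (rule Pi_I)
      fix v :: "'a vec" assume v: "v \<in> carrier_vec u"
      then have "v @\<^sub>v 0\<^sub>v (m - u) \<in> carrier_vec m"
        using assms by (intro carrier_vecI) simp
      then show "v @\<^sub>v 0\<^sub>v (m - u) \<in> coordinate_subspace m u"
        using v by (simp add: coordinate_subspace_def diff_less_mono)
    qed
    show "(\<lambda>w. vec_first w u) \<in> coordinate_subspace m u \<rightarrow> carrier_vec u"
      by (rule Pi_I) (rule vec_first_carrier)
    show "vec_first (v @\<^sub>v 0\<^sub>v (m - u)) u = v" if "v \<in> carrier_vec u" for v :: "'a vec"
      using that by (intro eq_vecI) (simp_all add: vec_first_def)
    show "vec_first w u @\<^sub>v 0\<^sub>v (m - u) = w" if "w \<in> coordinate_subspace m u" for w :: "'a vec"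
    proof (rule eq_vecI)
      have w: "w \<in> carrier_vec m" using that by (simp add: coordinate_subspace_def)
      then show "dim_vec (vec_first w u @\<^sub>v 0\<^sub>v (m - u)) = dim_vec w" using assms by simp
      fix i assume "i < dim_vec w"
      then have "i < m" using w by simp
      moreover have "w $ i = 0" if "u \<le> i"
        using \<open>w \<in> coordinate_subspace m u\<close> \<open>i < m\<close> that by (simp add: coordinate_subspace_def)
      ultimately show "(vec_first w u @\<^sub>v 0\<^sub>v (m - u)) $ i = w $ i"
        using w assms by (cases "i < u") (simp_all add: vec_first_def)
    qed
  qed
  from bij_betw_same_card[OF this] show ?thesis by (simp add: card_carrier_vec)
qed

text \<open>
  Spells out linear independence of \<open>{x, y}\<close> without linear combinations. The premise \<open>x \<noteq> y\<close> is
  needed because the set collapses to a singleton when \<open>x = y\<close>.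
\<close>

lemma lin_indpt_pair_iff:
  fixes x y :: "'a::field vec"
  assumes x: "x \<in> carrier_vec m" and y: "y \<in> carrier_vec m"
  shows "LinearCombinations.module.lin_indpt class_ring (module_vec TYPE('a) m) {x, y} \<longleftrightarrow>
    x \<noteq> 0\<^sub>v m \<and> y \<noteq> 0\<^sub>v m \<and> (x \<noteq> y \<longrightarrow> (\<forall>a. y \<noteq> a \<cdot>\<^sub>v x))"
proof -
  interpret vec_space "TYPE('a)" m .
  have lc: "lincomb c {x, y} $ i = c x * x $ i + c y * y $ i" if "x \<noteq> y" "i < m" for c i
    using lincomb_index[of i "{x, y}" c] that x y by simp
  have lc1: "lincomb c {x} $ i = c x * x $ i" if "i < m" for c i
    using lincomb_index[of i "{x}" c] that x y by simp
  show ?thesis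
  proof (intro iffI conjI impI allI)
    assume li: "lin_indpt {x, y}"
    have "0\<^sub>v m \<notin> {x, y}"
      using zero_lin_dep[of "{x, y}"] li by (metis UNIV_I singletonD zero_neq_one)
    then show "x \<noteq> 0\<^sub>v m" "y \<noteq> 0\<^sub>v m" by auto
    fix a assume "x \<noteq> y"
    show "y \<noteq> a \<cdot>\<^sub>v x"
    proof
      assume eq: "y = a \<cdot>\<^sub>v x"
      let ?c = "\<lambda>v. if v = x then - a else 1"
      have "lincomb ?c {x, y} = 0\<^sub>v m"
      proof (rule eq_vecI)
        fix i assume "i < dim_vec (0\<^sub>v m :: 'a vec)"
        then have i: "i < m" by simp
        have "y $ i = a * x $ i" using eq i x by simp
        then show "lincomb ?c {x, y} $ i = 0\<^sub>v m $ i" using lc[OF \<open>x \<noteq> y\<close> i, of ?c] \<open>x \<noteq> y\<close> i by simp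
      qed (use lincomb_dim[of "{x, y}"] x y in simp)
      then have "lin_dep {x, y}"
        using \<open>x \<noteq> y\<close> by (intro lin_dep_crit[where A = "{x, y}" and S = "{x, y}" and a = ?c and v = y]) auto
      then show False using li by simp
    qed
  next
    assume r: "x \<noteq> 0\<^sub>v m \<and> y \<noteq> 0\<^sub>v m \<and> (x \<noteq> y \<longrightarrow> (\<forall>a. y \<noteq> a \<cdot>\<^sub>v x))"
    show "lin_indpt {x, y}"
    proof
      assume "lin_dep {x, y}"
      then obtain c v where c: "lincomb c {x, y} = 0\<^sub>v m" "v \<in> {x, y}" "c v \<noteq> 0"
        using finite_lin_dep[of "{x, y}"] x y by auto
      have zero: "w = 0\<^sub>v m" if "w \<in> carrier_vec m" "b \<noteq> 0" "\<And>i. i < m \<Longrightarrow> b * w $ i = 0" for w and b :: 'a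
        using that by (intro eq_vecI) auto
      show False
      proof (cases "x = y")
        case True
        then have "x = 0\<^sub>v m" using lc1[of _ c] c x by (intro zero[of x "c x"]) auto
        then show False using r by simp
      next
        case False
        have eq: "c x * x $ i + c y * y $ i = 0" if "i < m" for i
          using lc[OF False that, of c] c that by simp
        show False
        proof (cases "c y = 0")
          case True
          then have "c x \<noteq> 0" using c by auto
          then have "x = 0\<^sub>v m" using eq True x by (intro zero[of x "c x"]) auto
          then show False using r by simp
        next
          case cy: False
          have "y = (- c x / c y) \<cdot>\<^sub>v x"
          proof (rule eq_vecI)
            fix i assume "i < dim_vec ((- c x / c y) \<cdot>\<^sub>v x)"
            then have i: "i < m" using x by simp
            have "c y * y $ i = - (c x * x $ i)" using eq[OF i] by (simp add: add_eq_0_iff)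
            then have "y $ i = - (c x * x $ i) / c y" using cy by (simp add: field_simps)
            then show "y $ i = ((- c x / c y) \<cdot>\<^sub>v x) $ i" using i x by simp
          qed (use x y in simp)
          then show False using r False by blast
        qed
      qed
    qed
  qed
qed


text \<open>
  Otherwise the vector could be added to the columns, contradicting their maximality.
\<close>

lemma ex_column_multiple:
  fixes H :: "'a::{field,finite} mat"
  assumes H: "hamming_parity_check m H" and v: "v \<in> carrier_vec m" "v \<noteq> 0\<^sub>v m"
  shows "\<exists>w \<in> set (cols H). \<exists>a. v = a \<cdot>\<^sub>v w"
proof (rule ccontr)
  let ?S = "set (cols H)"
  assume no: "\<not> (\<exists>w \<in> ?S. \<exists>a. v = a \<cdot>\<^sub>v w)"
  have S: "pairwise_lin_indpt m ?S"
    and max: "\<And>T. ?S \<subseteq> T \<Longrightarrow> pairwise_lin_indpt m T \<Longrightarrow> T = ?S"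
    using H by (auto simp: hamming_parity_check_def)
  have carr: "?S \<subseteq> carrier_vec m" using S by (simp add: pairwise_lin_indpt_def)
  have pair: "x \<noteq> 0\<^sub>v m \<and> y \<noteq> 0\<^sub>v m \<and> (x \<noteq> y \<longrightarrow> (\<forall>a. y \<noteq> a \<cdot>\<^sub>v x))"
    if "x \<in> ?S" "y \<in> ?S" for x y
    using S that carr lin_indpt_pair_iff[of x m y] unfolding pairwise_lin_indpt_def by blast
  have inv: "y \<noteq> a \<cdot>\<^sub>v v" if y: "y \<in> ?S" for y a
  proof
    assume eq: "y = a \<cdot>\<^sub>v v"
    have "a \<noteq> 0"
      using pair[OF y y] eq v(1) by auto
    then have "v = inverse a \<cdot>\<^sub>v y"
      using v(1) by (simp add: eq smult_smult_assoc)
    then show False using no y by blast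
  qed
  have "pairwise_lin_indpt m (insert v ?S)"
    unfolding pairwise_lin_indpt_def
  proof (intro conjI ballI)
    show "insert v ?S \<subseteq> carrier_vec m" using carr v by blast
    fix x y assume xy: "x \<in> insert v ?S" "y \<in> insert v ?S"
    have "x \<noteq> 0\<^sub>v m \<and> y \<noteq> 0\<^sub>v m \<and> (x \<noteq> y \<longrightarrow> (\<forall>a. y \<noteq> a \<cdot>\<^sub>v x))"
      using xy pair inv no v(2) by blast
    then show "LinearCombinations.module.lin_indpt class_ring (module_vec TYPE('a) m) {x, y}"
      using lin_indpt_pair_iff[of x m y] xy carr v(1) by blast
  qed
  then have "v \<in> ?S" using max by blast
  moreover have "v = 1 \<cdot>\<^sub>v v" by simp
  ultimately show False using no by blast
qed

text \<open>
  Injectivity is the pairwise independence of the columns. For surjectivity, a vector outside the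
  subspace is a multiple of some column of \<open>H\<close>, and that column cannot belong to \<open>Hs\<close>, since
  the multiples of the columns of \<open>Hs\<close> lie in the subspace.
\<close>

lemma bij_betw_multiples_of_columns:
  fixes H Hs Hr :: "'a::{field,finite} mat"
  assumes split: "hamming_split m u H Hs Hr" and Hr: "Hr \<in> carrier_mat m n"
  shows "bij_betw (\<lambda>(i, a). a \<cdot>\<^sub>v col Hr i) ({..<n} \<times> (UNIV - {0}))
    (carrier_vec m - coordinate_subspace m u)"
proof -
  let ?f = "\<lambda>(i, a). a \<cdot>\<^sub>v col Hr i"
  have H: "hamming_parity_check m H" and cols: "cols H = cols Hs @ cols Hr"
    and zero: "\<forall>v \<in> set (cols Hs). \<forall>i. u \<le> i \<and> i < m \<longrightarrow> v $ i = 0"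
    and nonzero: "\<forall>v \<in> set (cols Hr). \<exists>i. u \<le> i \<and> i < m \<and> v $ i \<noteq> 0"
    using split by (simp_all add: hamming_split_def)
  have S: "set (cols H) \<subseteq> carrier_vec m" and dist: "distinct (cols Hr)"
    using H cols by (auto simp: hamming_parity_check_def pairwise_lin_indpt_def)
  have set_cols: "set (cols Hr) = col Hr ` {..<n}"
    using Hr by (auto simp: cols_def)
  have pair: "y \<noteq> a \<cdot>\<^sub>v x" if "x \<in> set (cols Hr)" "y \<in> set (cols Hr)" "x \<noteq> y" for x y a
    using H that cols S lin_indpt_pair_iff[of x m y]
    unfolding hamming_parity_check_def pairwise_lin_indpt_def by auto
  have inj: "i = j" if "i < n" "j < n" "col Hr i = col Hr j" for i j
    using dist that Hr nth_eq_iff_index_eq[of "cols Hr" i j] by simp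
  have "inj_on ?f ({..<n} \<times> (UNIV - {0}))"
  proof (rule inj_onI)
    fix p q
    assume pq: "p \<in> {..<n} \<times> (UNIV - {0 :: 'a})" "q \<in> {..<n} \<times> (UNIV - {0 :: 'a})"
      and eq: "?f p = ?f q"
    obtain i a j b where [simp]: "p = (i, a)" "q = (j, b)" by (cases p, cases q)
    have ij: "i < n" "j < n" "a \<noteq> 0" "b \<noteq> 0" using pq by auto
    have eq': "a \<cdot>\<^sub>v col Hr i = b \<cdot>\<^sub>v col Hr j" using eq by simp
    have "col Hr j = (inverse b * a) \<cdot>\<^sub>v col Hr i"
      using arg_cong[OF eq', of "\<lambda>v. inverse b \<cdot>\<^sub>v v"] ij by (simp add: smult_smult_assoc)
    then have "col Hr i = col Hr j"
      using pair[of "col Hr i" "col Hr j"] ij set_cols by blast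
    then have "i = j" using inj ij by blast
    moreover obtain k where "k < m" "col Hr i $ k \<noteq> 0"
      using nonzero ij set_cols by blast
    then have "a = b"
      using arg_cong[OF eq', of "\<lambda>v. v $ k"] \<open>i = j\<close> Hr by simp
    ultimately show "p = q" by simp
  qed
  moreover have "?f ` ({..<n} \<times> (UNIV - {0})) = carrier_vec m - coordinate_subspace m u"
  proof (intro equalityI subsetI)
    fix v assume "v \<in> ?f ` ({..<n} \<times> (UNIV - {0}))"
    then obtain i a where i: "i < n" "a \<noteq> 0" and v: "v = a \<cdot>\<^sub>v col Hr i" by auto
    then obtain k where "u \<le> k" "k < m" "col Hr i $ k \<noteq> 0"
      using nonzero set_cols by blast
    then show "v \<in> carrier_vec m - coordinate_subspace m u"
      using i Hr by (auto simp: v coordinate_subspace_def)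
  next
    fix v :: "'a vec" assume v: "v \<in> carrier_vec m - coordinate_subspace m u"
    then obtain k where k: "u \<le> k" "k < m" "v $ k \<noteq> 0"
      by (auto simp: coordinate_subspace_def)
    then have "v \<noteq> 0\<^sub>v m" by auto
    then obtain w a where w: "w \<in> set (cols H)" "v = a \<cdot>\<^sub>v w"
      using ex_column_multiple[OF H] v by blast
    then have "a * w $ k \<noteq> 0" using k S by (auto simp: subset_iff)
    then have "w \<notin> set (cols Hs)" "a \<noteq> 0" using k zero by auto
    then have "w \<in> set (cols Hr)" using w cols by auto
    then obtain i where "i < n" "w = col Hr i" using set_cols by auto
    then show "v \<in> ?f ` ({..<n} \<times> (UNIV - {0}))"
      using \<open>a \<noteq> 0\<close> w by (intro image_eqI[of _ _ "(i, a)"]) auto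
  qed
  ultimately show ?thesis by (simp add: bij_betw_def)
qed

lemma zero_in_coordinate_subspace [simp]: "0\<^sub>v m \<in> coordinate_subspace m u"
  by (simp add: coordinate_subspace_def)

lemma minus_in_coordinate_subspace_iff:
  fixes s t :: "'a::ring vec"
  shows "s \<in> coordinate_subspace m u \<Longrightarrow> t \<in> carrier_vec m \<Longrightarrow>
      t - s \<in> coordinate_subspace m u \<longleftrightarrow> t \<in> coordinate_subspace m u"
    and "t \<in> coordinate_subspace m u \<Longrightarrow> s \<in> carrier_vec m \<Longrightarrow>
      t - s \<in> coordinate_subspace m u \<longleftrightarrow> s \<in> coordinate_subspace m u"
  by (auto simp: coordinate_subspace_def)

lemma mult_mat_unit_vec:
  fixes A :: "'a::semiring_1 mat"
  assumes "A \<in> carrier_mat r n" "i < n"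
  shows "A *\<^sub>v unit_vec n i = col A i"
  by (rule eq_vecI) (use assms in simp_all)

section \<open>Syndromes of neighbors\<close>

text \<open>
  The last assumption is what the Hamming property provides: the columns represent each line that
  is not contained in the subspace exactly once.
\<close>

locale columns_off_subspace =
  fixes Hr :: "'a::{field,finite} mat" and m u n :: nat
  assumes Hr: "Hr \<in> carrier_mat m n"
    and u_pos: "0 < u" and u_less: "u < m"
    and column_multiples: "bij_betw (\<lambda>(i, a). a \<cdot>\<^sub>v col Hr i) ({..<n} \<times> (UNIV - {0}))
      (carrier_vec m - coordinate_subspace m u)"
begin

abbreviation U :: "'a vec set" where "U \<equiv> coordinate_subspace m u"
abbreviation B :: "'a vec set" where "B \<equiv> mat_kernel Hr"
abbreviation syn :: "'a vec \<Rightarrow> 'a vec" where "syn x \<equiv> Hr *\<^sub>v x"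

lemma syn_carrier [simp]: "syn x \<in> carrier_vec m"
  using Hr by (intro carrier_vecI) simp

lemma U_subset: "U \<subseteq> carrier_vec m"
  by (auto simp: coordinate_subspace_def)

lemma finite_U [simp]: "finite U"
  by (rule finite_subset[OF U_subset]) simp

lemma card_U: "card U = CARD('a) ^ u"
  by (intro card_coordinate_subspace less_imp_le u_less)

lemma card_complement_U: "card (carrier_vec m - U) = CARD('a) ^ m - CARD('a) ^ u"
  by (simp add: card_Diff_subset U_subset card_U card_carrier_vec)

lemma mem_B_iff: "x \<in> B \<longleftrightarrow> x \<in> carrier_vec n \<and> syn x = 0\<^sub>v m"
  using Hr by (auto simp: mat_kernel)

lemma B_subset: "B \<subseteq> carrier_vec n"
  by (auto simp: mem_B_iff)

lemma finite_B [simp]: "finite B"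
  by (rule finite_subset[OF B_subset]) simp

lemma zero_in_B: "0\<^sub>v n \<in> B"
  using Hr by (auto simp: mem_B_iff intro!: eq_vecI)

text \<open>
  A neighbor \<open>x + a e\<^sub>i\<close> has syndrome \<open>syn x + a h\<^sub>i\<close>, where \<open>h\<^sub>i\<close> is the \<open>i\<close>th column, and the vectors
  \<open>a h\<^sub>i\<close> with \<open>a \<noteq> 0\<close> run through the complement of \<open>U\<close>, each occurring once.
\<close>

lemma bij_betw_syn_neighbors:
  assumes x: "x \<in> carrier_vec n"
  shows "bij_betw syn (neighbors n x) {t \<in> carrier_vec m. t - syn x \<notin> U}"
proof -
  let ?g = "\<lambda>(i, a). x + a \<cdot>\<^sub>v unit_vec n i" and ?f = "\<lambda>(i, a). a \<cdot>\<^sub>v col Hr i"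
  let ?I = "{..<n} \<times> (UNIV - {0 :: 'a})"
  have "bij_betw (\<lambda>t. syn x + t) (carrier_vec m - U) {t \<in> carrier_vec m. t - syn x \<notin> U}"
  proof (rule bij_betwI[where g = "\<lambda>t. t - syn x"])
    have *: "syn x + t - syn x = t" if "t \<in> carrier_vec m" for t
      using that by (intro eq_vecI) (use Hr in simp_all)
    then show "syn x + t - syn x = t" if "t \<in> carrier_vec m - U" for t
      using that by blast
    show "(\<lambda>t. syn x + t) \<in> carrier_vec m - U \<rightarrow> {t \<in> carrier_vec m. t - syn x \<notin> U}"
      using * by auto
    show "(\<lambda>t. t - syn x) \<in> {t \<in> carrier_vec m. t - syn x \<notin> U} \<rightarrow> carrier_vec m - U"
      by auto
    show "syn x + (t - syn x) = t" if "t \<in> {t \<in> carrier_vec m. t - syn x \<notin> U}" for t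
      using that by (intro eq_vecI) (use Hr in auto)
  qed
  then have "bij_betw ((\<lambda>t. syn x + t) \<circ> ?f) ?I {t \<in> carrier_vec m. t - syn x \<notin> U}"
    by (rule bij_betw_trans[OF column_multiples])
  moreover have "((\<lambda>t. syn x + t) \<circ> ?f) p = (syn \<circ> ?g) p" if p: "p \<in> ?I" for p
  proof -
    obtain i a where [simp]: "p = (i, a)" by (cases p)
    have "i < n" using p by simp
    then have "syn (a \<cdot>\<^sub>v unit_vec n i) = a \<cdot>\<^sub>v col Hr i"
      using mult_mat_vec[OF Hr, of "unit_vec n i" a] mult_mat_unit_vec[OF Hr] by simp
    moreover have "syn (x + a \<cdot>\<^sub>v unit_vec n i) = syn x + syn (a \<cdot>\<^sub>v unit_vec n i)"
      by (rule mult_add_distrib_mat_vec[OF Hr x]) simp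
    ultimately show ?thesis by simp
  qed
  ultimately have "bij_betw (syn \<circ> ?g) ?I {t \<in> carrier_vec m. t - syn x \<notin> U}"
    by (simp cong: bij_betw_cong)
  then show ?thesis
    using bij_betw_comp_iff[OF bij_betw_neighbors[OF x]] by blast
qed

text \<open>The form in which the bijection is used for counting.\<close>

lemma card_neighbors_syn:
  assumes x: "x \<in> carrier_vec n" and T: "T \<subseteq> carrier_vec m"
  shows "card {y \<in> neighbors n x. syn y \<in> T} = card {t \<in> T. t - syn x \<notin> U}"
proof -
  have inj: "inj_on syn (neighbors n x)"
    and im: "syn ` neighbors n x = {t \<in> carrier_vec m. t - syn x \<notin> U}"
    using bij_betw_syn_neighbors[OF x] by (auto simp: bij_betw_def)
  have "card {y \<in> neighbors n x. syn y \<in> T} = card (syn ` {y \<in> neighbors n x. syn y \<in> T})"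
    by (rule card_image[symmetric]) (rule inj_on_subset[OF inj], blast)
  also have "syn ` {y \<in> neighbors n x. syn y \<in> T} = syn ` neighbors n x \<inter> T" by blast
  also have "\<dots> = {t \<in> T. t - syn x \<notin> U}" unfolding im using T by blast
  finally show ?thesis .
qed

lemma n_eq: "n * (CARD('a) - 1) = CARD('a) ^ m - CARD('a) ^ u"
  using bij_betw_same_card[OF column_multiples] card_complement_U by (simp add: card_Diff_subset)

lemma card_neighbors:
  fixes x :: "'a vec"
  assumes x: "x \<in> carrier_vec n"
  shows "card (neighbors n x) = CARD('a) ^ m - CARD('a) ^ u"
  using bij_betw_same_card[OF bij_betw_neighbors[OF x]] n_eq by (simp add: card_Diff_subset)

text \<open>
  A neighbor with syndrome \<open>0\<close> exists, and then is unique, if and only if \<open>0 - syn x \<notin> U\<close>.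
\<close>

lemma card_codeword_neighbors:
  assumes x: "x \<in> carrier_vec n"
  shows "card (neighbors n x \<inter> B) = (if syn x \<in> U then 0 else 1)"
proof -
  have "neighbors n x \<inter> B = {y \<in> neighbors n x. syn y \<in> {0\<^sub>v m}}"
    using neighbors_subset_carrier[of n x] by (auto simp: mem_B_iff)
  then have "card (neighbors n x \<inter> B) = card {t \<in> {0\<^sub>v m}. t - syn x \<notin> U}"
    using card_neighbors_syn[OF x, of "{0\<^sub>v m}"] by simp
  also have "{t \<in> {0\<^sub>v m}. t - syn x \<notin> U} = (if syn x \<in> U then {} else {0\<^sub>v m})"
    using minus_in_coordinate_subspace_iff(2)[of "0\<^sub>v m" m u "syn x"] by auto
  finally show ?thesis by simp
qed

lemma ex_vec_not_in_U: "\<exists>w \<in> carrier_vec m. w \<notin> U"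
proof
  show "unit_vec m (m - 1) \<notin> U"
    using u_less by (auto simp: coordinate_subspace_def intro!: exI[of _ "m - 1"])
qed simp

lemma ex_neighbor_syn:
  assumes x: "x \<in> carrier_vec n" and t: "t \<in> carrier_vec m" "t - syn x \<notin> U"
  shows "\<exists>y \<in> neighbors n x. syn y = t"
proof -
  have "t \<in> syn ` neighbors n x"
    using bij_betw_imp_surj_on[OF bij_betw_syn_neighbors[OF x]] t by simp
  then show ?thesis by blast
qed

text \<open>
  A word with syndrome in \<open>U\<close> has a neighbor with syndrome outside \<open>U\<close>, which in turn has a
  codeword neighbor; so no distance exceeds 2.
\<close>

lemma dist_to_B:
  assumes x: "x \<in> carrier_vec n"
  shows "dist_to_code x B = (if syn x = 0\<^sub>v m then 0 else if syn x \<notin> U then 1 else 2)"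
proof -
  have B: "B \<noteq> {}" using zero_in_B by blast
  have le0: "dist_to_code x B \<le> 0 \<longleftrightarrow> syn x = 0\<^sub>v m"
    unfolding dist_to_code_le_iff[OF B]
    using hamming_dist_eq_0_iff[OF x] B_subset x mem_B_iff by auto
  have le1: "dist_to_code x B \<le> 1 \<longleftrightarrow> syn x = 0\<^sub>v m \<or> syn x \<notin> U"
  proof -
    have "dist_to_code x B \<le> 1 \<longleftrightarrow> dist_to_code x B \<le> 0 \<or> (\<exists>c \<in> B. hamming_dist x c = 1)"
      unfolding dist_to_code_le_iff[OF B] by (auto simp: le_Suc_eq)
    also have "(\<exists>c \<in> B. hamming_dist x c = 1) \<longleftrightarrow> neighbors n x \<inter> B \<noteq> {}"
      using B_subset by (auto simp: neighbors_def)
    also have "\<dots> \<longleftrightarrow> card (neighbors n x \<inter> B) \<noteq> 0" by simp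
    also have "\<dots> \<longleftrightarrow> syn x \<notin> U" using card_codeword_neighbors[OF x] by simp
    finally show ?thesis using le0 by simp
  qed
  have le2: "dist_to_code x B \<le> 2" if s: "syn x \<in> U"
  proof -
    obtain w where w: "w \<in> carrier_vec m" "w \<notin> U" using ex_vec_not_in_U by blast
    then obtain y where y: "y \<in> neighbors n x" "syn y = w"
      using ex_neighbor_syn[OF x] minus_in_coordinate_subspace_iff(1)[OF s] by blast
    then have y': "y \<in> carrier_vec n" by (simp add: neighbors_def)
    then have "card (neighbors n y \<inter> B) \<noteq> 0"
      using card_codeword_neighbors[OF y'] y w by simp
    then have "neighbors n y \<inter> B \<noteq> {}" by (metis card.empty)
    then obtain c where "c \<in> neighbors n y" "c \<in> B" by blast
    moreover have "hamming_dist x c \<le> hamming_dist x y + hamming_dist y c"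
      using x y' by (intro hamming_dist_triangle) simp
    ultimately show ?thesis
      unfolding dist_to_code_le_iff[OF B] using y(1)
      by (intro bexI[of _ c]) (simp_all add: neighbors_def)
  qed
  show ?thesis
    using le0 le1 le2 by auto
qed

lemma layer_eq:
  "layer n B 0 = B"
  "layer n B 1 = {x \<in> carrier_vec n. syn x \<notin> U}"
  "layer n B 2 = {x \<in> carrier_vec n. syn x \<in> U - {0\<^sub>v m}}"
  "layer n B 3 = {}"
  by (auto simp: layer_def dist_to_B mem_B_iff split: if_splits)

text \<open>The simplifier rewrites \<open>1\<close> to \<open>Suc 0\<close>, so the middle layer is provided in both forms.\<close>

lemmas layers = layer_eq layer_eq(2)[unfolded One_nat_def]


section \<open>Intersection numbers\<close>

text \<open>
  For a word with syndrome \<open>s\<close>, the condition \<open>t - s \<notin> U\<close> holds for all \<open>t \<in> U\<close> if \<open>s \<notin> U\<close>, and for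
  none of them if \<open>s \<in> U\<close>. This determines the counts in the layers 0 and 2; the middle layer
  contains the remaining neighbors.
\<close>

lemma card_neighbors_layers:
  assumes x: "x \<in> layer n B l"
  shows "card (neighbors n x \<inter> layer n B 0) = (if l = 1 then 1 else 0)"
    and "card (neighbors n x \<inter> layer n B 1) =
      (if l = 1 then CARD('a) ^ m - CARD('a) ^ u - CARD('a) ^ u else CARD('a) ^ m - CARD('a) ^ u)"
    and "card (neighbors n x \<inter> layer n B 2) = (if l = 1 then CARD('a) ^ u - 1 else 0)"
proof -
  have xn: "x \<in> carrier_vec n" using x by (simp add: layer_def)
  have l: "l = 1 \<longleftrightarrow> syn x \<notin> U"
    using x dist_to_B[OF xn] by (auto simp: layer_def split: if_splits)
  have L1: "neighbors n x \<inter> layer n B 1 = {y \<in> neighbors n x. syn y \<in> carrier_vec m - U}"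
    and L2: "neighbors n x \<inter> layer n B 2 = {y \<in> neighbors n x. syn y \<in> U - {0\<^sub>v m}}"
    using neighbors_subset_carrier[of n x] by (auto simp: layers)
  show c0: "card (neighbors n x \<inter> layer n B 0) = (if l = 1 then 1 else 0)"
    using card_codeword_neighbors[OF xn] l by (simp add: layers)
  have "{t \<in> U - {0\<^sub>v m}. t - syn x \<notin> U} = (if l = 1 then U - {0\<^sub>v m} else {})"
    using minus_in_coordinate_subspace_iff(2)[of _ m u "syn x"] l by auto
  then show c2: "card (neighbors n x \<inter> layer n B 2) = (if l = 1 then CARD('a) ^ u - 1 else 0)"
    unfolding L2 card_neighbors_syn[OF xn, OF order.trans[OF Diff_subset U_subset]]
    by (simp add: card_U)
  have "neighbors n x = (neighbors n x \<inter> layer n B 0) \<union> (neighbors n x \<inter> layer n B 1) \<union>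
      (neighbors n x \<inter> layer n B 2)"
    using neighbors_subset_carrier[of n x] unfolding layer_eq by (auto simp: mem_B_iff)
  also have "card \<dots> = card (neighbors n x \<inter> layer n B 0) + card (neighbors n x \<inter> layer n B 1) +
      card (neighbors n x \<inter> layer n B 2)"
    by (subst card_Un_disjoint; (subst card_Un_disjoint)?) (auto simp: layer_def)
  finally have "card (neighbors n x \<inter> layer n B 1) + card (neighbors n x \<inter> layer n B 0) +
      card (neighbors n x \<inter> layer n B 2) = CARD('a) ^ m - CARD('a) ^ u"
    using card_neighbors[OF xn] by simp
  moreover have "0 < CARD('a) ^ u" by simp
  ultimately show "card (neighbors n x \<inter> layer n B 1) =
      (if l = 1 then CARD('a) ^ m - CARD('a) ^ u - CARD('a) ^ u else CARD('a) ^ m - CARD('a) ^ u)"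
    unfolding c0 c2 by (simp split: if_splits)
qed

text \<open>
  The syndrome map is onto: starting from the zero word, two steps reach a word whose syndrome is
  the first unit vector, passing through a word with syndrome outside \<open>U\<close>.
\<close>

lemma layer_2_nonempty: "layer n B 2 \<noteq> {}"
proof -
  let ?e = "unit_vec m 0 :: 'a vec"
  have e: "?e \<in> U" "?e \<noteq> 0\<^sub>v m" using u_pos u_less by (auto simp: coordinate_subspace_def)
  obtain w where w: "w \<in> carrier_vec m" "w \<notin> U" using ex_vec_not_in_U by blast
  have z: "0\<^sub>v n \<in> carrier_vec n" "syn (0\<^sub>v n) = 0\<^sub>v m" using zero_in_B by (simp_all add: mem_B_iff)
  have "w - syn (0\<^sub>v n) \<notin> U"
    using minus_in_coordinate_subspace_iff(1)[of "syn (0\<^sub>v n)" m u w] w unfolding z(2) by simp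
  then obtain y where "y \<in> neighbors n (0\<^sub>v n)" and yw: "syn y = w"
    using ex_neighbor_syn[OF z(1) w(1)] by blast
  then have y: "y \<in> carrier_vec n" by (simp add: neighbors_def)
  have "?e - syn y \<notin> U"
    unfolding yw using minus_in_coordinate_subspace_iff(2)[OF e(1) w(1)] w(2) by simp
  then obtain x where "x \<in> neighbors n y" "syn x = ?e"
    using ex_neighbor_syn[OF y, of ?e] by auto
  then have "x \<in> layer n B 2"
    unfolding layer_eq using e by (simp add: neighbors_def)
  then show ?thesis by blast
qed

lemma covering_radius_B: "covering_radius n B = 2"
proof -
  let ?D = "{dist_to_code v B | v. v \<in> carrier_vec n}"
  have sub: "?D \<subseteq> {0, 1, 2}" using dist_to_B by (auto split: if_splits)
  have "2 \<in> ?D" using layer_2_nonempty by (force simp: layer_def)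
  moreover have "finite ?D" using sub by (rule finite_subset) simp
  ultimately show ?thesis
    unfolding covering_radius_def using sub by (intro Max_eqI) auto
qed

lemma intersection_numbers_B:
  "intersection_numbers n B
     (\<lambda>l. if l = 0 then CARD('a) ^ m - CARD('a) ^ u else if l = 1 then CARD('a) ^ u - 1 else 0)
     (\<lambda>l. if l = 0 then 0 else if l = 1 then 1 else CARD('a) ^ m - CARD('a) ^ u)"
  unfolding intersection_numbers_def covering_radius_B
proof (intro conjI allI impI ballI)
  fix l x assume l: "l \<le> 2" and x: "x \<in> layer n B l"
  note N = card_neighbors_layers[OF x]
  consider "l = 0" | "l = 1" | "l = 2" using l by linarith
  note cs = this
  show "card (neighbors n x \<inter> layer n B (l + 1)) =
      (if l = 0 then CARD('a) ^ m - CARD('a) ^ u else if l = 1 then CARD('a) ^ u - 1 else 0)"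
    using cs by cases (use N in \<open>simp_all add: layer_eq(4) flip: One_nat_def numeral_2_eq_2\<close>)
  show "card (neighbors n x \<inter> layer n B (l - 1)) =
      (if l = 0 then 0 else if l = 1 then 1 else CARD('a) ^ m - CARD('a) ^ u)" if "0 < l"
    using cs by cases (use N that in \<open>simp_all flip: One_nat_def\<close>)
qed simp_all

section \<open>Codewords at distance 2 and the packing radius\<close>

text \<open>
  A codeword has no codeword neighbor, and two codewords at distance 2 would be codeword neighbors
  of the same word.
\<close>

lemma hamming_dist_codewords_ge_3:
  assumes c: "c \<in> B" and c': "c' \<in> B" and "c \<noteq> c'"
  shows "3 \<le> hamming_dist c c'"
proof (rule ccontr)
  assume "\<not> 3 \<le> hamming_dist c c'"
  moreover have cn: "c \<in> carrier_vec n" "c' \<in> carrier_vec n" using c c' B_subset by auto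
  moreover have "hamming_dist c c' \<noteq> 0" using hamming_dist_eq_0_iff[OF cn] \<open>c \<noteq> c'\<close> by simp
  ultimately consider "hamming_dist c c' = 1" | "hamming_dist c c' = 2" by linarith
  then show False
  proof cases
    case 1
    then have "c' \<in> neighbors n c \<inter> B" using cn c' by (simp add: neighbors_def)
    moreover have "card (neighbors n c \<inter> B) = 0"
      using card_codeword_neighbors[OF cn(1)] c by (simp add: mem_B_iff)
    ultimately show False by auto
  next
    case 2
    then have "card (neighbors n c \<inter> neighbors n c') = 2"
      using card_common_neighbors_of_dist_2[OF cn] by simp
    then obtain y where y: "y \<in> neighbors n c" "y \<in> neighbors n c'"
      by (metis Int_iff card.empty ex_in_conv zero_neq_numeral)
    then have yn: "y \<in> carrier_vec n" by (simp add: neighbors_def)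
    then have "{c, c'} \<subseteq> neighbors n y \<inter> B" using y c c' cn mem_neighbors_commute by blast
    then have "card {c, c'} \<le> card (neighbors n y \<inter> B)" by (intro card_mono) simp_all
    also have "\<dots> \<le> 1" using card_codeword_neighbors[OF yn] by simp
    finally show False using \<open>c \<noteq> c'\<close> by simp
  qed
qed

text \<open>
  Each codeword \<open>c\<close> at distance 2 is reached by exactly two paths \<open>x - y - c\<close>. Conversely, the
  middle vertex \<open>y\<close> determines \<open>c\<close>, its only codeword neighbor; the vertices \<open>y\<close> that do not count
  are those whose codeword neighbor is already adjacent to \<open>x\<close>.
\<close>

lemma two_card_codewords_at_dist_2:
  assumes x: "x \<in> carrier_vec n" "x \<notin> B"
  shows "2 * card {c \<in> B. hamming_dist x c = 2} =
    card {y \<in> neighbors n x \<inter> layer n B 1. neighbors n y \<inter> neighbors n x \<inter> B = {}}"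
proof -
  let ?C = "{c \<in> B. hamming_dist x c = 2}"
  let ?Y = "{y \<in> neighbors n x \<inter> layer n B 1. neighbors n y \<inter> neighbors n x \<inter> B = {}}"
  let ?P = "SIGMA c:?C. neighbors n x \<inter> neighbors n c"
  have "card ?P = (\<Sum>c\<in>?C. card (neighbors n x \<inter> neighbors n c))"
    by (rule card_SigmaI) simp_all
  also have "\<dots> = (\<Sum>c\<in>?C. 2)"
    by (rule sum.cong) (use card_common_neighbors_of_dist_2[OF x(1)] B_subset in auto)
  finally have "card ?P = 2 * card ?C" by simp
  moreover have "bij_betw snd ?P ?Y"
    unfolding bij_betw_def
  proof
    have uniq: "c = c'" if "c \<in> B" "c' \<in> B" "y \<in> neighbors n c" "y \<in> neighbors n c'" for c c' y
    proof -
      have yn: "y \<in> carrier_vec n" using that by (simp add: neighbors_def)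
      then have sub: "{c, c'} \<subseteq> neighbors n y \<inter> B"
        using that mem_neighbors_commute B_subset by blast
      have "card {c, c'} \<le> card (neighbors n y \<inter> B)" by (intro card_mono sub) simp_all
      also have "\<dots> \<le> 1" using card_codeword_neighbors[OF yn] by simp
      finally show "c = c'" by (cases "c = c'") simp_all
    qed
    show "inj_on snd ?P" by (rule inj_onI) (use uniq in auto)
    show "snd ` ?P = ?Y"
    proof (intro equalityI subsetI)
      fix y assume "y \<in> snd ` ?P"
      then obtain c where c: "c \<in> B" "hamming_dist x c = 2" "y \<in> neighbors n x" "y \<in> neighbors n c"
        by auto
      then have yn: "y \<in> carrier_vec n" by (simp add: neighbors_def)
      have cn: "c \<in> carrier_vec n" using c B_subset by blast
      have "c \<in> neighbors n y \<inter> B" using c mem_neighbors_commute[OF cn yn] by simp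
      then have "card (neighbors n y \<inter> B) \<noteq> 0" by auto
      then have "y \<in> layer n B 1"
        using card_codeword_neighbors[OF yn] yn by (auto simp: layers split: if_splits)
      moreover have "c' \<notin> neighbors n x" if "c' \<in> neighbors n y" "c' \<in> B" for c'
      proof -
        have "c' = c"
          using uniq[of c' c y] that c mem_neighbors_commute[OF _ yn] B_subset by blast
        then show ?thesis using c(2) by (simp add: neighbors_def)
      qed
      ultimately show "y \<in> ?Y" using c by blast
    next
      fix y assume y: "y \<in> ?Y"
      then have yn: "y \<in> carrier_vec n" and "syn y \<notin> U" by (auto simp: layers)
      then have "card (neighbors n y \<inter> B) = 1" using card_codeword_neighbors by simp
      then obtain c where c: "c \<in> neighbors n y" "c \<in> B"
        by (metis Int_iff card.empty ex_in_conv zero_neq_one)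
      then have cn: "c \<in> carrier_vec n" using B_subset by blast
      have "hamming_dist x c \<le> hamming_dist x y + hamming_dist y c"
        using x yn by (intro hamming_dist_triangle) simp
      then have "hamming_dist x c \<le> 2" using y c by (simp add: neighbors_def)
      moreover have "hamming_dist x c \<noteq> 0" using hamming_dist_eq_0_iff[OF x(1) cn] x c by auto
      moreover have "hamming_dist x c \<noteq> 1"
        using y c cn by (auto simp: neighbors_def)
      ultimately have "hamming_dist x c = 2" by linarith
      moreover have "y \<in> neighbors n c" using c mem_neighbors_commute[OF cn yn] by simp
      ultimately have "(c, y) \<in> ?P" using y c by simp
      then show "y \<in> snd ` ?P" by (rule rev_image_eqI) simp
    qed
  qed
  then have "card ?P = card ?Y" by (rule bij_betw_same_card)
  ultimately show ?thesis by (simp only:)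
qed

text \<open>No neighbor is excluded here, as \<open>x\<close> has no codeword neighbor.\<close>

lemma two_card_codewords_at_dist_2_layer_2:
  assumes x: "x \<in> layer n B 2"
  shows "2 * card {c \<in> B. hamming_dist x c = 2} = CARD('a) ^ m - CARD('a) ^ u"
proof -
  have xn: "x \<in> carrier_vec n" "x \<notin> B" using x by (auto simp: layers mem_B_iff)
  have "neighbors n x \<inter> B = {}"
    using card_neighbors_layers(1)[OF x] by (simp add: layers)
  then have "{y \<in> neighbors n x \<inter> layer n B 1. neighbors n y \<inter> neighbors n x \<inter> B = {}}
      = neighbors n x \<inter> layer n B 1" by blast
  then show ?thesis
    using two_card_codewords_at_dist_2[OF xn] card_neighbors_layers(2)[OF x] by simp
qed

text \<open>
  Here \<open>x\<close> has a single codeword neighbor \<open>c\<close>, so the \<open>q - 2\<close> common neighbors of \<open>x\<close> and \<open>c\<close>,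
  all of which lie in the middle layer, are excluded.
\<close>

lemma two_card_codewords_at_dist_2_layer_1:
  assumes x: "x \<in> layer n B 1"
  shows "2 * card {c \<in> B. hamming_dist x c = 2} =
    CARD('a) ^ m - CARD('a) ^ u - CARD('a) ^ u - (CARD('a) - 2)"
proof -
  have xn: "x \<in> carrier_vec n" "x \<notin> B" using x by (auto simp: layers mem_B_iff)
  have "card (neighbors n x \<inter> B) = 1"
    using card_neighbors_layers(1)[OF x] by (simp add: layers)
  then obtain c where c: "neighbors n x \<inter> B = {c}" by (auto simp: card_1_singleton_iff)
  then have cB: "c \<in> B" "c \<in> neighbors n x" by blast+
  then have cn: "c \<in> carrier_vec n" using B_subset by blast
  have "c \<in> layer n B 0" using cB by (simp add: layers)
  then have "card (neighbors n c \<inter> layer n B 1) = card (neighbors n c)"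
    using card_neighbors_layers(2) card_neighbors[OF cn] by simp
  then have nc: "neighbors n c \<subseteq> layer n B 1"
    using card_subset_eq[OF finite_neighbors Int_lower1] by blast
  have "{y \<in> neighbors n x \<inter> layer n B 1. neighbors n y \<inter> neighbors n x \<inter> B = {}}
      = neighbors n x \<inter> layer n B 1 - neighbors n x \<inter> neighbors n c"
  proof -
    have "neighbors n y \<inter> neighbors n x \<inter> B = {} \<longleftrightarrow> y \<notin> neighbors n c"
      if "y \<in> neighbors n x" for y
    proof -
      have "y \<in> carrier_vec n" using that by (simp add: neighbors_def)
      then have "y \<in> neighbors n c \<longleftrightarrow> c \<in> neighbors n y" using mem_neighbors_commute[OF cn] by blast
      moreover have "neighbors n y \<inter> neighbors n x \<inter> B = neighbors n y \<inter> {c}"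
        using c by blast
      ultimately show ?thesis by simp
    qed
    then show ?thesis by blast
  qed
  also have "card \<dots> = card (neighbors n x \<inter> layer n B 1) - card (neighbors n x \<inter> neighbors n c)"
    by (rule card_Diff_subset) (use nc in auto)
  also have "card (neighbors n x \<inter> neighbors n c) = CARD('a) - 2"
    by (rule card_common_neighbors_of_adjacent[OF xn(1) cB(2)])
  finally show ?thesis
    using two_card_codewords_at_dist_2[OF xn] card_neighbors_layers(2)[OF x] by simp
qed

text \<open>
  The minimum distance is at most 4 because two codewords at distance 2 from a common word exist as
  soon as \<open>q\<^sup>m - q\<^sup>u > 2\<close>; the case distinction isolates the code \<open>{0}\<close> of length 2 over the field
  with two elements.
\<close>

lemma packing_radius_B: "packing_radius B = 1"
proof -
  let ?q = "CARD('a)"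
  let ?D = "{hamming_dist x y | x y. x \<in> B \<and> y \<in> B \<and> x \<noteq> y}"
  have le_n: "hamming_dist x y \<le> n" if "x \<in> carrier_vec n" for x y :: "'a vec"
    using hamming_dist_le_dim[of x y] that by simp
  then have "?D \<subseteq> {..n}" using B_subset by blast
  then have fin: "finite ?D" by (rule finite_subset) simp
  have "min_distance B \<in> {3, 4}"
  proof (cases "?q ^ m - ?q ^ u \<le> 2")
    case True
    have "card {0 :: 'a, 1} \<le> ?q" by (rule card_mono) simp_all
    then have q: "2 \<le> ?q" by simp
    \<comment> \<open>From \<open>(q - 1) q \<le> (q - 1) q\<^sup>u \<le> q\<^sup>m - q\<^sup>u \<le> 2\<close> it follows that \<open>q = 2\<close>; then \<open>n = q\<^sup>m - q\<^sup>u = 2\<close>.\<close>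
    have "?q ^ Suc u \<le> ?q ^ m" using u_less q by (intro power_increasing) simp_all
    then have "(?q - 1) * ?q ^ u \<le> ?q ^ m - ?q ^ u" by (simp add: diff_mult_distrib)
    moreover have "?q ^ 1 \<le> ?q ^ u" using u_pos q by (intro power_increasing) simp_all
    then have qu: "(?q - 1) * ?q \<le> (?q - 1) * ?q ^ u" by simp
    ultimately have "(?q - 1) * ?q \<le> 2" using True by linarith
    moreover have "2 * 3 \<le> (?q - 1) * ?q" if "3 \<le> ?q" using that by (intro mult_le_mono) simp_all
    ultimately have q2: "?q = 2" using q by fastforce
    then have "n = ?q ^ m - ?q ^ u" using n_eq by simp
    then have n2: "n = 2"
      using True \<open>(?q - 1) * ?q ^ u \<le> ?q ^ m - ?q ^ u\<close> qu q2 by simp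
    \<comment> \<open>Distinct codewords are at distance at least 3, which exceeds the length.\<close>
    have "c = 0\<^sub>v n" if "c \<in> B" for c
    proof (rule ccontr)
      assume "c \<noteq> 0\<^sub>v n"
      then have "3 \<le> hamming_dist c (0\<^sub>v n)"
        using hamming_dist_codewords_ge_3 that zero_in_B by blast
      then show False using le_n[of c "0\<^sub>v n"] that B_subset n2 by auto
    qed
    then have "B = {0\<^sub>v 2}" using zero_in_B n2 by blast
    then show ?thesis using q2 by (simp add: min_distance_def)
  next
    case False
    obtain x where x: "x \<in> layer n B 2" using layer_2_nonempty by blast
    have "2 \<le> card {c \<in> B. hamming_dist x c = 2}"
      using two_card_codewords_at_dist_2_layer_2[OF x] False by linarith
    then obtain T where T: "T \<subseteq> {c \<in> B. hamming_dist x c = 2}" "card T = 2"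
      by (meson obtain_subset_with_card_n)
    then obtain c c' where "T = {c, c'}" "c \<noteq> c'" by (auto simp: card_2_iff)
    then have c: "c \<in> B" "hamming_dist x c = 2" "c' \<in> B" "hamming_dist x c' = 2" "c \<noteq> c'"
      using T(1) by blast+
    have d: "hamming_dist c c' \<in> ?D" using c by blast
    have dim: "dim_vec x = dim_vec c" using x c(1) B_subset by (auto simp: layer_def)
    have "hamming_dist c c' \<le> hamming_dist c x + hamming_dist x c'"
      by (rule hamming_dist_triangle) (simp add: dim)
    then have "hamming_dist c c' \<le> 4"
      using c hamming_dist_commute[OF dim] by simp
    then have "Min ?D \<le> 4" using Min_le[OF fin d] by linarith
    moreover have "3 \<le> Min ?D"
    proof (rule Min.boundedI[OF fin])
      show "?D \<noteq> {}" using d by blast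
    qed (use hamming_dist_codewords_ge_3 in blast)
    moreover have "B \<noteq> {0\<^sub>v 2}" using c(1,3,5) by (metis singletonD)
    ultimately show ?thesis unfolding min_distance_def by auto
  qed
  then show ?thesis by (auto simp: packing_radius_def)
qed

lemma quasi_perfect_B: "quasi_perfect n B"
  by (simp add: quasi_perfect_def packing_radius_B covering_radius_B)

lemma uniformly_packed_B: "uniformly_packed n B"
  unfolding uniformly_packed_def
proof (intro conjI exI ballI impI)
  show "quasi_perfect n B" by (rule quasi_perfect_B)
  have two: "packing_radius B + 1 = 2" by (simp add: packing_radius_B)
  fix x :: "'a vec" assume x: "x \<in> carrier_vec n"
  show "card {y \<in> B. hamming_dist x y = packing_radius B + 1} =
      (CARD('a) ^ m - CARD('a) ^ u - CARD('a) ^ u - (CARD('a) - 2)) div 2"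
    if "dist_to_code x B = packing_radius B"
    using two_card_codewords_at_dist_2_layer_1[of x] x that
    unfolding two unfolding packing_radius_B
    by (simp add: layer_def)
  show "card {y \<in> B. hamming_dist x y = packing_radius B + 1} =
      (CARD('a) ^ m - CARD('a) ^ u) div 2"
    if "dist_to_code x B = packing_radius B + 1"
    using two_card_codewords_at_dist_2_layer_2[of x] x that
    unfolding two unfolding packing_radius_B
    by (simp add: layer_def)
qed

lemma has_intersection_array_B:
  "has_intersection_array n B
     [CARD('a) ^ m - CARD('a) ^ u, CARD('a) ^ u - 1] [1, CARD('a) ^ m - CARD('a) ^ u]"
  unfolding has_intersection_array_def
  by (intro exI conjI, rule intersection_numbers_B) (simp_all add: covering_radius_B upt_rec)

end

theorem corollary1:
  fixes H Hs Hr :: "'a::{field,finite} mat" and q m u n :: nat and B :: "'a vec set"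
  assumes "q = CARD('a)"
    and "m > 1" and "1 \<le> u" and "u \<le> m - 1"
    and "hamming_split m u H Hs Hr"
    and "n = (q ^ m - q ^ u) div (q - 1)"
    and "B = mat_kernel Hr"
  shows "quasi_perfect n B \<and> uniformly_packed n B \<and> completely_regular n B \<and>
    has_intersection_array n B [q ^ m - q ^ u, q ^ u - 1] [1, q ^ m - q ^ u]"
proof -
  have Hr: "Hr \<in> carrier_mat m n"
    using assms(1,5,6) by (simp add: hamming_split_def)
  interpret columns_off_subspace Hr m u n
  proof
    show "0 < u" "u < m" using assms(2-4) by linarith+
  qed (rule Hr bij_betw_multiples_of_columns[OF assms(5) Hr])+
  have "completely_regular n (mat_kernel Hr)"
    unfolding completely_regular_def by (intro exI) (rule intersection_numbers_B)
  then show ?thesis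
    unfolding assms(1,7)
    by (intro conjI quasi_perfect_B uniformly_packed_B has_intersection_array_B)
qed

end
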